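(* Let $\{X^k\}$ be the sequence of sets produced by FPD_NMT (the algorithm described in the context, run without stopping criterion) started from a set $X^0\subset\Omega$ of mutually nondominated points, with $\sigma_k\to0$. Suppose that: (1) for all iterations $k>0$, the sets $\bar X^{l(k-1)}$ and $X^{l(k)}$ selected by the algorithm are equal; (2) at each iteration $k$, the first point of $X^k$ to be processed in the for loop belongs to $\arg\min_{x\in X^k}\theta(x)$; (3) there is a point $x_0\in X^0$ such that $\mathcal L(x_0)=\bigcup_{j=1}^m\{x\in\Omega\mid f_j(x)\le f_j(x_0)\}$ is compact. Then there exists an infinite $K\subseteq\{0,1,\ldots\}$ with $\lim_{k\in K,\,k\to\infty}\Theta(X^k)=0$, and for any such $K$ and any sequence $\{x^k\}$ with $x^k\in X^k$ for all $k$, the subsequence $\{x^k\}_{k\in K}$ admits accumulation points and every accumulation point of it is Pareto-stationary.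
   Context: **Problem and order.** $F=(f_1,\dots,f_m)^\top:\mathbb R^n\to\mathbb R^m$ is continuously differentiable; $\Omega=[l,u]\subseteq\mathbb R^n$ is a nonempty box (bounds possibly infinite). The problem is to minimize $F$ over $\Omega$. For $a,b\in\mathbb R^m$: $a\le b$ iff $a_j\le b_j$ for all $j$; $a<b$ iff $a_j<b_j$ for all $j$; $a\lneqq b$ iff $a\le b$ and $a\ne b$. A set $X\subseteq\Omega$ consists of mutually nondominated points if there are no $x,y\in X$ with $F(y)\lneqq F(x)$. $\mathbf 1$ is the all-ones vector of $\mathbb R^m$, and $\mathbb N\ni0$ in the ranges of line-search exponents. **Pareto-stationarity.** $\bar x\in\Omega$ is Pareto-stationary if $\min_{d\in\mathcal D(\bar x)}\max_{j=1,\dots,m}\nabla f_j(\bar x)^\top d=0$, where $\mathcal D(\bar x)=\{w\in\mathbb R^n\mid\exists\bar t>0:\bar x+tw\in\Omega\ \forall t\in[0,\bar t\,]\}$. **Directions.** For $x\in\Omega$ and nonempty $I\subseteq\{1,\dots,m\}$, $v^I(x)$ and $\theta^I(x)$ are the unique minimizer and the optimal value of $\min\{\max_{j\in I}\nabla f_j(x)^\top d+\frac12\|d\|^2: d\in\mathbb R^n,\ x+d\in\Omega\}$. Write $v=v^I,\theta=\theta^I$ for $I=\{1,\dots,m\}$. Also $D(x,d)=\max_{j=1,\dots,m}\nabla f_j(x)^\top d$. **Set stationarity measure.** For a set $X\subseteq\Omega$ of mutually nondominated points, $\Theta(X)=\inf_{x\in X}\theta(x)$. **Hyper-volume.** Given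 a reference point $\zeta\in\mathbb R^m$ and $Y\subseteq\mathbb R^m$, $\Lambda(Y)=\{y\in\mathbb R^m\mid\exists\bar y\in Y:\bar y\le y\le\zeta\}$, and $V(Y)$ is the Lebesgue measure of $\Lambda(Y)$. For $X\subset\Omega$, $V_F(X)=V(F(X))$. When the algorithm selects sets of smallest hyper-volume at iteration $k$, the reference point has components $\max_{x\in X_{\rm all}}f_j(x)$, $j=1,\dots,m$, where $X_{\rm all}$ is the union of all solutions generated so far. **Algorithm FPD_NMT.** Input: finite set $X^0\subset\Omega$ of mutually nondominated points, $\alpha_0\in(0,1]$, $\delta,\gamma\in(0,1)$, a sequence $\{\sigma_k\}\subseteq\mathbb R_+$ of nonnegative reals, a positive integer $M$. Set $C^{-1}=\emptyset$. For $k=0,1,2,\dots$: 1. Choose $X^{l(k)}\in\arg\min V_F(X)$ over $X\in\{X^k,X^{k-1},\dots,X^{k-\min\{k,M\}}\}$. 2. $\bar C^k=\{x\in X^{l(k)}\cup C^{k-1}\mid\nexists y\in X^{l(k)}\cup C^{k-1}:F(y)\lneqq F(x)\}$. 3. $C^k=\bar C^k\cup\{x\in X^k\mid\forall y\in\bar C^k\ \exists j: f_j(y)<f_j(x)\}$. 4. Initialize $\hat X^k=C^k$. 5. For each $x_p\in X^k$ (for loop), if there is no $y\in\hat X^k$ (current set) with $F(y)\lneqq F(x_p)$, do: (5a) If $\theta(x_p)<-\sigma_k$: if there is $c\in\hat X^k$ with $F(x_p)\le F(c)$, let $\alpha_p^k$ be the largest $\alpha\in\{\alpha_0\delta^h:h\in\mathbb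 N\}$ such that there exists $c_p^k\in\hat X^k$ with $F(x_p)\le F(c_p^k)$ and $F(x_p+\alpha v(x_p))\le F(c_p^k)+\mathbf 1\gamma\alpha D(x_p,v(x_p))$; otherwise let $\alpha_p^k$ be the largest $\alpha\in\{\alpha_0\delta^h:h\in\mathbb N\}$ with $F(x_p+\alpha v(x_p))\le F(x_p)+\mathbf 1\gamma\alpha D(x_p,v(x_p))$. If instead $\theta(x_p)\ge-\sigma_k$, set $\alpha_p^k=0$. (5b) $z_p^k=x_p+\alpha_p^kv(x_p)$. (5c) $\hat X^k\leftarrow(\hat X^k\cup\{z_p^k\})\setminus\{y\in\hat X^k\mid F(z_p^k)\lneqq F(y)\}$. (5d) For each nonempty $I\subseteq\{1,\dots,m\}$ with $\theta^I(z_p^k)<0$: if $z_p^k\in\hat X^k$, let $\alpha_p^I$ be the largest $\alpha\in\{\alpha_0\delta^h:h\in\mathbb N\}$ such that for all $y\in\hat X^k$ there is $j\in\{1,\dots,m\}$ with $f_j(z_p^k+\alpha v^I(z_p^k))<f_j(y)$; put $w=z_p^k+\alpha_p^Iv^I(z_p^k)$ and $\hat X^k\leftarrow(\hat X^k\cup\{w\})\setminus\{y\in\hat X^k\mid F(w)\lneqq F(y)\}$. 6. With $\hat X^k$ the set after the loop, choose $\bar X^{l(k)}\in\arg\min V_F(X)$ over $X\in\{\hat X^k\}\cup\{X^k,X^{k-1},\dots,X^{k-\min\{k,M-1\}}\}$. 7. $X^{k+1}=\{x\in\hat X^k\cup\bar X^{l(k)}\mid\nexists y\in\hat X^k\cup\bar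 X^{l(k)}:F(y)\lneqq F(x)\}$. *)

theory Defs
  imports "HOL-Analysis.Analysis"
begin

section \<open>The multi-objective problem\<close>

definition extended_box :: "('n \<Rightarrow> ereal) \<Rightarrow> ('n \<Rightarrow> ereal) \<Rightarrow> (real^'n) set" where
  "extended_box l u = {x. \<forall>i. l i \<le> ereal (x $ i) \<and> ereal (x $ i) \<le> u i}"

definition grad :: "('a::real_inner \<Rightarrow> real) \<Rightarrow> 'a \<Rightarrow> 'a" where
  "grad f x = (THE D. GDERIV f x :> D)"

definition continuously_differentiable :: "(real^'n \<Rightarrow> real^'m) \<Rightarrow> bool" where
  "continuously_differentiable F \<longleftrightarrow>
     (\<forall>j. (\<forall>x. (\<lambda>y. F y $ j) differentiable (at x)) \<and>
          continuous_on UNIV (grad (\<lambda>y. F y $ j)))"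

text \<open>
  The order \<open>\<le>\<close> on \<open>real^'m\<close> is componentwise; the library's \<open><\<close> on \<open>real^'m\<close> is not strict in
  every component, but coincides with the relation below.
\<close>

definition dominates :: "real^'m \<Rightarrow> real^'m \<Rightarrow> bool" where
  "dominates a b \<longleftrightarrow> a \<le> b \<and> a \<noteq> b"

definition mutually_nondominated :: "('a \<Rightarrow> real^'m) \<Rightarrow> 'a set \<Rightarrow> bool" where
  "mutually_nondominated F X \<longleftrightarrow> \<not> (\<exists>x\<in>X. \<exists>y\<in>X. dominates (F y) (F x))"

definition nondominated :: "('a \<Rightarrow> real^'m) \<Rightarrow> 'a set \<Rightarrow> 'a set" where
  "nondominated F X = {x \<in> X. \<not> (\<exists>y\<in>X. dominates (F y) (F x))}"

definition max_slope :: "(real^'n \<Rightarrow> real^'m) \<Rightarrow> 'm set \<Rightarrow> real^'n \<Rightarrow> real^'n \<Rightarrow> real" where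
  "max_slope F I x d = (MAX j\<in>I. grad (\<lambda>y. F y $ j) x \<bullet> d)"

definition feasible_directions :: "(real^'n) set \<Rightarrow> real^'n \<Rightarrow> (real^'n) set" where
  "feasible_directions \<Omega> x = {w. \<exists>t'>0. \<forall>t\<in>{0..t'}. x + t *\<^sub>R w \<in> \<Omega>}"

definition pareto_stationary :: "(real^'n \<Rightarrow> real^'m) \<Rightarrow> (real^'n) set \<Rightarrow> real^'n \<Rightarrow> bool" where
  "pareto_stationary F \<Omega> x \<longleftrightarrow> x \<in> \<Omega> \<and>
     (\<exists>d. is_arg_min (max_slope F UNIV x) (\<lambda>w. w \<in> feasible_directions \<Omega> x) d \<and>
          max_slope F UNIV x d = 0)"

definition direction_objective ::
    "(real^'n \<Rightarrow> real^'m) \<Rightarrow> 'm set \<Rightarrow> real^'n \<Rightarrow> real^'n \<Rightarrow> real" where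
  "direction_objective F I x d = max_slope F I x d + 1/2 * (norm d)\<^sup>2"

definition descent_dir ::
    "(real^'n \<Rightarrow> real^'m) \<Rightarrow> (real^'n) set \<Rightarrow> 'm set \<Rightarrow> real^'n \<Rightarrow> real^'n" where
  "descent_dir F \<Omega> I x = (THE d. is_arg_min (direction_objective F I x) (\<lambda>d. x + d \<in> \<Omega>) d)"

definition theta :: "(real^'n \<Rightarrow> real^'m) \<Rightarrow> (real^'n) set \<Rightarrow> 'm set \<Rightarrow> real^'n \<Rightarrow> real" where
  "theta F \<Omega> I x = (INF d\<in>{d. x + d \<in> \<Omega>}. direction_objective F I x d)"

definition set_theta :: "(real^'n \<Rightarrow> real^'m) \<Rightarrow> (real^'n) set \<Rightarrow> (real^'n) set \<Rightarrow> real" where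
  "set_theta F \<Omega> X = (INF x\<in>X. theta F \<Omega> UNIV x)"

section \<open>Hyper-volume\<close>

definition dominated_region :: "real^'m \<Rightarrow> (real^'m) set \<Rightarrow> (real^'m) set" where
  "dominated_region \<zeta> Y = {y. \<exists>y'\<in>Y. y' \<le> y \<and> y \<le> \<zeta>}"

definition hypervolume :: "('a \<Rightarrow> real^'m) \<Rightarrow> real^'m \<Rightarrow> 'a set \<Rightarrow> ennreal" where
  "hypervolume F \<zeta> X = emeasure lebesgue (dominated_region \<zeta> (F ` X))"

definition reference_point :: "('a \<Rightarrow> real^'m) \<Rightarrow> 'a set \<Rightarrow> real^'m" where
  "reference_point F Xall = (\<chi> j. MAX x\<in>Xall. F x $ j)"

section \<open>The algorithm\<close>

text \<open>
  The algorithm leaves open which minimizer of the hyper-volume is taken and in which order the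
  loops run through their index sets, so it is modelled as a relation that admits every choice.
\<close>

definition largest_step :: "real \<Rightarrow> real \<Rightarrow> (real \<Rightarrow> bool) \<Rightarrow> real \<Rightarrow> bool" where
  "largest_step \<alpha>0 \<delta> P \<alpha> \<longleftrightarrow>
     is_arg_max (\<lambda>a. a) (\<lambda>a. a \<in> range (\<lambda>h::nat. \<alpha>0 * \<delta> ^ h) \<and> P a) \<alpha>"

primrec for_each :: "('a \<Rightarrow> 's \<Rightarrow> 's \<Rightarrow> bool) \<Rightarrow> 'a list \<Rightarrow> 's \<Rightarrow> 's \<Rightarrow> bool" where
  "for_each R [] s s' \<longleftrightarrow> s' = s"
| "for_each R (x # xs) s s' \<longleftrightarrow> (\<exists>s''. R x s s'' \<and> for_each R xs s'' s')"

definition candidates :: "('a \<Rightarrow> real^'m) \<Rightarrow> 'a set \<Rightarrow> 'a set \<Rightarrow> 'a set \<Rightarrow> 'a set" where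
  "candidates F X Xl Cprev =
     (let Cbar = nondominated F (Xl \<union> Cprev)
      in Cbar \<union> {x \<in> X. \<forall>y\<in>Cbar. \<exists>j. F y $ j < F x $ j})"

definition insert_point :: "('a \<Rightarrow> real^'m) \<Rightarrow> 'a \<Rightarrow> 'a set \<Rightarrow> 'a set" where
  "insert_point F z X = (X \<union> {z}) - {y \<in> X. dominates (F z) (F y)}"

definition common_step ::
    "(real^'n \<Rightarrow> real^'m) \<Rightarrow> (real^'n) set \<Rightarrow> real \<Rightarrow> real \<Rightarrow> real \<Rightarrow> real \<Rightarrow>
     (real^'n) set \<Rightarrow> real^'n \<Rightarrow> real \<Rightarrow> bool" where
  "common_step F \<Omega> \<alpha>0 \<delta> \<gamma> \<sigma> Xh x \<alpha> \<longleftrightarrow>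
     (let v = descent_dir F \<Omega> UNIV x; D = max_slope F UNIV x v in
      if theta F \<Omega> UNIV x < - \<sigma> then
        (if \<exists>c\<in>Xh. F x \<le> F c then
           largest_step \<alpha>0 \<delta>
             (\<lambda>a. \<exists>c\<in>Xh. F x \<le> F c \<and> F (x + a *\<^sub>R v) \<le> F c + (\<gamma> * a * D) *\<^sub>R 1) \<alpha>
         else
           largest_step \<alpha>0 \<delta> (\<lambda>a. F (x + a *\<^sub>R v) \<le> F x + (\<gamma> * a * D) *\<^sub>R 1) \<alpha>)
      else \<alpha> = 0)"

text \<open>
  In the loops below, a state \<open>(Xh, G)\<close> consists of the current set \<open>Xh\<close> of the iteration and
  the set \<open>G\<close> of all points generated so far, which determines the reference point of the
  hyper-volume.
\<close>

definition partial_step ::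
    "(real^'n \<Rightarrow> real^'m) \<Rightarrow> (real^'n) set \<Rightarrow> real \<Rightarrow> real \<Rightarrow> real^'n \<Rightarrow> 'm set \<Rightarrow>
     (real^'n) set \<times> (real^'n) set \<Rightarrow> (real^'n) set \<times> (real^'n) set \<Rightarrow> bool" where
  "partial_step F \<Omega> \<alpha>0 \<delta> z I = (\<lambda>(Xh, G) (Xh', G').
     if z \<in> Xh then
       \<exists>\<alpha> w. largest_step \<alpha>0 \<delta>
               (\<lambda>a. \<forall>y\<in>Xh. \<exists>j. F (z + a *\<^sub>R descent_dir F \<Omega> I z) $ j < F y $ j) \<alpha> \<and>
             w = z + \<alpha> *\<^sub>R descent_dir F \<Omega> I z \<and>
             Xh' = insert_point F w Xh \<and> G' = insert w G
     else Xh' = Xh \<and> G' = G)"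

definition process_point ::
    "(real^'n \<Rightarrow> real^'m) \<Rightarrow> (real^'n) set \<Rightarrow> real \<Rightarrow> real \<Rightarrow> real \<Rightarrow> real \<Rightarrow> real^'n \<Rightarrow>
     (real^'n) set \<times> (real^'n) set \<Rightarrow> (real^'n) set \<times> (real^'n) set \<Rightarrow> bool" where
  "process_point F \<Omega> \<alpha>0 \<delta> \<gamma> \<sigma> x = (\<lambda>(Xh, G) s'.
     if \<exists>y\<in>Xh. dominates (F y) (F x) then s' = (Xh, G)
     else
       \<exists>\<alpha> z Is. common_step F \<Omega> \<alpha>0 \<delta> \<gamma> \<sigma> Xh x \<alpha> \<and>
                z = x + \<alpha> *\<^sub>R descent_dir F \<Omega> UNIV x \<and>
                distinct Is \<and> set Is = {I. I \<noteq> {} \<and> theta F \<Omega> I z < 0} \<and>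
                for_each (partial_step F \<Omega> \<alpha>0 \<delta> z) Is (insert_point F z Xh, insert z G) s')"

text \<open>
  In iteration \<open>k\<close>, \<open>Xl k\<close> and \<open>Xbar k\<close> are the two sets selected by hyper-volume, \<open>Xhat k\<close> is
  the set after the loop, \<open>ord k\<close> lists the points of \<open>X k\<close> in the order in which the loop
  processes them, and \<open>G k\<close> is the set of all points generated before the iteration.
\<close>

definition fpd_nmt_run ::
    "(real^'n \<Rightarrow> real^'m) \<Rightarrow> (real^'n) set \<Rightarrow> real \<Rightarrow> real \<Rightarrow> real \<Rightarrow> (nat \<Rightarrow> real) \<Rightarrow> nat \<Rightarrow>
     (nat \<Rightarrow> (real^'n) set) \<Rightarrow> (nat \<Rightarrow> (real^'n) set) \<Rightarrow> (nat \<Rightarrow> (real^'n) set) \<Rightarrow>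
     (nat \<Rightarrow> (real^'n) list) \<Rightarrow> (nat \<Rightarrow> (real^'n) set) \<Rightarrow> (nat \<Rightarrow> (real^'n) set) \<Rightarrow>
     (nat \<Rightarrow> (real^'n) set) \<Rightarrow> bool" where
  "fpd_nmt_run F \<Omega> \<alpha>0 \<delta> \<gamma> \<sigma> M X Xl C ord Xhat Xbar G \<longleftrightarrow>
     G 0 = X 0 \<and>
     (\<forall>k. is_arg_min (hypervolume F (reference_point F (G k)))
            (\<lambda>Y. Y \<in> X ` {k - min k M..k}) (Xl k) \<and>
          C k = candidates F (X k) (Xl k) (case k of 0 \<Rightarrow> {} | Suc i \<Rightarrow> C i) \<and>
          distinct (ord k) \<and> set (ord k) = X k \<and>
          for_each (process_point F \<Omega> \<alpha>0 \<delta> \<gamma> (\<sigma> k)) (ord k) (C k, G k) (Xhat k, G (Suc k)) \<and>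
          is_arg_min (hypervolume F (reference_point F (G (Suc k))))
            (\<lambda>Y. Y \<in> insert (Xhat k) (X ` {k - min k (M - 1)..k})) (Xbar k) \<and>
          X (Suc k) = nondominated F (Xhat k \<union> Xbar k))"

section \<open>Limits along infinite index sets\<close>

definition tends_along :: "(nat \<Rightarrow> 'a::topological_space) \<Rightarrow> 'a \<Rightarrow> nat set \<Rightarrow> bool" where
  "tends_along f L K \<longleftrightarrow> (f \<longlongrightarrow> L) (inf sequentially (principal K))"

definition accumulation_point_along ::
    "(nat \<Rightarrow> 'a::topological_space) \<Rightarrow> nat set \<Rightarrow> 'a \<Rightarrow> bool" where
  "accumulation_point_along f K L \<longleftrightarrow>
     (\<exists>r. strict_mono r \<and> range r \<subseteq> K \<and> (f \<circ> r) \<longlonglongrightarrow> L)"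

end

theory Submission
  imports Defs
begin

text \<open>
  The hyper-volumes play no role. Order sets of points by covering: each point of the first set is
  weakly dominated by one of the second. The sets \<open>C k\<close> increase in this order, and they are mutually
  nondominated because the two selections agree. If \<open>\<theta>\<close> stayed below some \<open>-e < 0\<close> at the first
  processed points, the line search there would accept steps bounded away from zero, so that
  iteration \<open>k\<close> would produce a point whose image lies at least \<open>\<eta>\<close> below that of some \<open>c\<close> in \<open>C k\<close>,
  in every component. Since \<open>Xl k = X i\<close> for some \<open>i\<close> with \<open>k - M \<le> i\<close>, and \<open>X i\<close> covers what was produced in
  iteration \<open>i - 1\<close>, the sets \<open>C k\<close> would cover such points for infinitely many iterations. The
  corresponding images of the points \<open>c\<close> would then be pairwise separated by \<open>\<eta>\<close> in the compact
  image of the level set. Stationarity of accumulation points is upper semicontinuity of \<open>\<theta>\<close>.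
\<close>

section \<open>The direction-finding subproblem\<close>

text \<open>\<open>grad\<close> is a definite description: the vector \<open>adjoint f' 1\<close>
  representing the derivative gives existence, and uniqueness of derivatives does the rest.\<close>

lemma GDERIV_grad:
  fixes f :: "'a::euclidean_space \<Rightarrow> real"
  assumes "f differentiable (at x)"
  shows "GDERIV f x :> grad f x"
proof -
  obtain f' where f': "(f has_derivative f') (at x)"
    using assms by (auto simp: differentiable_def)
  have "f' h = h \<bullet> adjoint f' 1" for h
    using adjoint_works[OF has_derivative_linear[OF f'], of h 1] by simp
  then have "f' = (\<lambda>h. h \<bullet> adjoint f' 1)"
    by (rule ext)
  then have ex: "GDERIV f x :> adjoint f' 1"
    unfolding gderiv_def by (metis f')
  show ?thesis
    unfolding grad_def
  proof (rule theI[of "\<lambda>D. GDERIV f x :> D", OF ex])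
    fix D assume "GDERIV f x :> D"
    then have "(\<lambda>h. h \<bullet> D) = (\<lambda>h. h \<bullet> adjoint f' 1)"
      using ex unfolding gderiv_def by (rule has_derivative_unique)
    then have "\<forall>h. h \<bullet> D = h \<bullet> adjoint f' 1"
      unfolding fun_eq_iff .
    then show "D = adjoint f' 1"
      by (simp only: vector_eq_ldot)
  qed
qed

lemma continuous_on_MAX:
  fixes f :: "'i \<Rightarrow> 'a::topological_space \<Rightarrow> real"
  assumes "finite I" "I \<noteq> {}" "\<And>i. i \<in> I \<Longrightarrow> continuous_on S (f i)"
  shows "continuous_on S (\<lambda>x. MAX i\<in>I. f i x)"
  using assms
proof (induction I rule: finite_ne_induct)
  case (insert i I)
  then show ?case
    by (auto intro!: continuous_on_max)
qed auto

text \<open>The box is abstracted to a closed convex set: closedness yields minimizers of the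
  subproblem, convexity their uniqueness and the feasibility of steps in [0,1].\<close>

locale smooth_problem =
  fixes F :: "real^'n \<Rightarrow> real^'m" and \<Omega> :: "(real^'n) set"
  assumes F_C1: "continuously_differentiable F"
    and closed: "closed \<Omega>" and convex: "convex \<Omega>"
begin

abbreviation g :: "'m \<Rightarrow> real^'n \<Rightarrow> real^'n" where
  "g j \<equiv> grad (\<lambda>y. F y $ j)"

abbreviation v :: "'m set \<Rightarrow> real^'n \<Rightarrow> real^'n" where
  "v \<equiv> descent_dir F \<Omega>"

abbreviation D :: "real^'n \<Rightarrow> real" where
  "D x \<equiv> max_slope F UNIV x (v UNIV x)"

abbreviation \<theta> :: "'m set \<Rightarrow> real^'n \<Rightarrow> real" where
  "\<theta> \<equiv> theta F \<Omega>"

section \<open>Regularity of \<open>F\<close> and of the subproblem\<close>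

lemma continuous_grad: "continuous_on UNIV (g j)"
  using F_C1 by (simp add: continuously_differentiable_def)

lemma has_derivative_component: "((\<lambda>y. F y $ j) has_derivative (\<lambda>h. h \<bullet> g j x)) (at x)"
  using F_C1 GDERIV_grad[of "\<lambda>y. F y $ j" x]
  by (simp add: continuously_differentiable_def gderiv_def)

lemma continuous_F: "continuous_on UNIV F"
proof -
  have "isCont (\<lambda>y. F y $ j) x" for j x
    using has_derivative_continuous[OF has_derivative_component] .
  then have "continuous_on UNIV (\<lambda>y. \<chi> j. F y $ j)"
    by (intro continuous_on_vec_lambda continuous_at_imp_continuous_on) simp
  then show ?thesis
    by (simp only: vec_lambda_eta)
qed

lemma max_slope_ge: "j \<in> I \<Longrightarrow> g j x \<bullet> d \<le> max_slope F I x d"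
  unfolding max_slope_def by (intro Max_ge) auto

lemma max_slope_le_iff: "I \<noteq> {} \<Longrightarrow> max_slope F I x d \<le> c \<longleftrightarrow> (\<forall>j\<in>I. g j x \<bullet> d \<le> c)"
  unfolding max_slope_def by (subst Max_le_iff) auto

lemma max_slope_zero: "I \<noteq> {} \<Longrightarrow> max_slope F I x 0 = 0"
  unfolding max_slope_def by simp

lemma max_slope_scaleR:
  assumes "I \<noteq> {}" "0 \<le> t"
  shows "max_slope F I x (t *\<^sub>R d) = t * max_slope F I x d"
proof -
  have "mono ((*) t)" using assms by (simp add: mono_def mult_left_mono)
  then have "t * Max ((\<lambda>j. g j x \<bullet> d) ` I) = Max ((*) t ` (\<lambda>j. g j x \<bullet> d) ` I)"
    using assms by (intro mono_Max_commute) auto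
  then show ?thesis by (simp add: max_slope_def image_image)
qed

lemma continuous_max_slope:
  assumes "I \<noteq> {}"
  shows "continuous_on UNIV (\<lambda>p. max_slope F I (fst p) (snd p))"
  unfolding max_slope_def using assms
  by (intro continuous_on_MAX continuous_intros continuous_on_compose2[OF continuous_grad]) auto

lemma continuous_direction_objective:
  assumes "I \<noteq> {}"
  shows "continuous_on UNIV (\<lambda>p. direction_objective F I (fst p) (snd p))"
  unfolding direction_objective_def
  by (intro continuous_intros continuous_max_slope assms)

text \<open>Cauchy-Schwarz for a single gradient gives coercivity: the objective is nonnegative once
  \<open>norm d\<close> reaches \<open>2 * norm (g j x)\<close>.\<close>

lemma direction_objective_ge:
  assumes "j \<in> I"
  shows "norm d * (norm d / 2 - norm (g j x)) \<le> direction_objective F I x d"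
proof -
  have "- (norm (g j x) * norm d) \<le> g j x \<bullet> d"
    using Cauchy_Schwarz_ineq2[of "g j x" d] by linarith
  moreover have "norm d * (norm d / 2 - norm (g j x)) = 1/2 * (norm d)\<^sup>2 - norm (g j x) * norm d"
    by (simp add: right_diff_distrib power2_eq_square)
  ultimately show ?thesis
    using max_slope_ge[OF assms, of x d] unfolding direction_objective_def by linarith
qed

text \<open>By coercivity the objective is nonnegative outside the ball in \<open>K\<close>, and it
  vanishes at 0. A minimizer over the compact set \<open>K\<close> is therefore global.\<close>

lemma ex_direction_minimizer:
  assumes "x \<in> \<Omega>" "I \<noteq> {}"
  shows "\<exists>d. is_arg_min (direction_objective F I x) (\<lambda>d. x + d \<in> \<Omega>) d"
proof -
  let ?\<phi> = "direction_objective F I x"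
  obtain j where j: "j \<in> I" using assms by blast
  define K where "K = {d. x + d \<in> \<Omega>} \<inter> cball 0 (2 * norm (g j x))"
  have "closed ((\<lambda>d. x + d) -` \<Omega>)"
    by (intro closed_vimage closed continuous_intros)
  then have "compact K"
    by (auto simp: K_def vimage_def intro!: closed_Int_compact)
  moreover have K0: "0 \<in> K" using assms by (simp add: K_def)
  moreover have "continuous_on K ?\<phi>"
    using continuous_on_compose2[OF continuous_direction_objective[OF assms(2)]
        continuous_on_Pair[OF continuous_on_const[of K x] continuous_on_id]] by simp
  ultimately obtain d where d: "d \<in> K" "\<And>e. e \<in> K \<Longrightarrow> ?\<phi> d \<le> ?\<phi> e"
    using continuous_attains_inf[of K ?\<phi>] by blast
  have "?\<phi> d \<le> ?\<phi> e" if "x + e \<in> \<Omega>" for e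
  proof (cases "e \<in> K")
    case False
    then have "0 \<le> norm e * (norm e / 2 - norm (g j x))"
      using that by (auto simp: K_def)
    moreover have "?\<phi> d \<le> 0"
      using d(2)[OF K0] assms by (simp add: direction_objective_def max_slope_zero)
    ultimately show ?thesis
      using direction_objective_ge[OF j, of e x] by linarith
  qed (use d in blast)
  then show ?thesis
    using d(1) by (auto simp: is_arg_min_linorder K_def)
qed

text \<open>Uniqueness is strict convexity, tested at the midpoint by the parallelogram law.\<close>
lemma direction_minimizer_unique:
  assumes I: "I \<noteq> {}"
    and d: "is_arg_min (direction_objective F I x) (\<lambda>d. x + d \<in> \<Omega>) d"
    and e: "is_arg_min (direction_objective F I x) (\<lambda>d. x + d \<in> \<Omega>) e"
  shows "d = e"
proof -
  let ?\<phi> = "direction_objective F I x"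
  define m where "m = (1/2) *\<^sub>R (d + e)"
  have "x + m = (1/2) *\<^sub>R (x + d) + (1/2) *\<^sub>R (x + e)"
    by (simp add: m_def algebra_simps flip: scaleR_left_distrib)
  then have "x + m \<in> \<Omega>"
    using convexD[OF convex, of "x + d" "x + e" "1/2" "1/2"] d e by (simp add: is_arg_min_linorder)
  then have min: "?\<phi> d \<le> ?\<phi> m" and eq: "?\<phi> d = ?\<phi> e"
    using d e by (auto simp: is_arg_min_linorder intro: antisym)
  have slope: "max_slope F I x m \<le> (max_slope F I x d + max_slope F I x e) / 2"
    unfolding max_slope_le_iff[OF I]
  proof
    fix j assume "j \<in> I"
    then show "g j x \<bullet> m \<le> (max_slope F I x d + max_slope F I x e) / 2"
      using max_slope_ge[of j I x d] max_slope_ge[of j I x e] by (simp add: m_def inner_add_right)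
  qed
  define q where "q = (norm (d - e))\<^sup>2"
  have "(norm m)\<^sup>2 = ((norm d)\<^sup>2 + (norm e)\<^sup>2) / 2 - q / 4"
    unfolding m_def q_def power2_norm_eq_inner
    by (simp add: inner_add_left inner_add_right inner_diff_left inner_diff_right
        inner_commute[of e d] add_divide_distrib diff_divide_distrib)
  then have "q \<le> 0"
    using min eq slope unfolding direction_objective_def by (simp add: field_simps)
  then show ?thesis by (simp add: q_def)
qed

section \<open>The direction \<open>v\<close> and the value \<open>\<theta>\<close>\<close>

lemma is_arg_min_descent_dir:
  assumes "x \<in> \<Omega>" "I \<noteq> {}"
  shows "is_arg_min (direction_objective F I x) (\<lambda>d. x + d \<in> \<Omega>) (v I x)"
proof -
  have "\<exists>!d. is_arg_min (direction_objective F I x) (\<lambda>d. x + d \<in> \<Omega>) d"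
    using ex_direction_minimizer[OF assms] direction_minimizer_unique[OF assms(2)] by blast
  then show ?thesis
    unfolding descent_dir_def by (rule theI')
qed

lemma descent_dir_feasible: "x \<in> \<Omega> \<Longrightarrow> I \<noteq> {} \<Longrightarrow> x + v I x \<in> \<Omega>"
  using is_arg_min_descent_dir by (auto simp: is_arg_min_linorder)

lemma descent_step_feasible:
  assumes "x \<in> \<Omega>" "I \<noteq> {}" "0 \<le> t" "t \<le> 1"
  shows "x + t *\<^sub>R v I x \<in> \<Omega>"
  using convexD_alt[OF convex assms(1) descent_dir_feasible[OF assms(1,2)] assms(3,4)]
  by (simp add: algebra_simps)

lemma theta_eq:
  assumes "x \<in> \<Omega>" "I \<noteq> {}"
  shows "\<theta> I x = direction_objective F I x (v I x)"
proof -
  have "x + v I x \<in> \<Omega>" "\<And>d. x + d \<in> \<Omega> \<Longrightarrow>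
      direction_objective F I x (v I x) \<le> direction_objective F I x d"
    using is_arg_min_descent_dir[OF assms] by (simp_all add: is_arg_min_linorder)
  then show ?thesis
    unfolding theta_def by (intro cInf_eq_minimum) blast+
qed

lemma theta_le:
  assumes "x \<in> \<Omega>" "I \<noteq> {}" "x + d \<in> \<Omega>"
  shows "\<theta> I x \<le> direction_objective F I x d"
  using is_arg_min_descent_dir[OF assms(1,2)] assms(3)
  by (simp add: theta_eq[OF assms(1,2)] is_arg_min_linorder)

lemma theta_nonpos: "x \<in> \<Omega> \<Longrightarrow> I \<noteq> {} \<Longrightarrow> \<theta> I x \<le> 0"
  using theta_le[of x I 0] by (simp add: direction_objective_def max_slope_zero)

lemma max_slope_descent_dir_le: "x \<in> \<Omega> \<Longrightarrow> D x \<le> \<theta> UNIV x"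
  by (simp add: theta_eq direction_objective_def)

text \<open>The optimal value is at most 0, the value at direction 0, while the coercive bound is
  positive beyond this radius.\<close>

lemma norm_descent_dir_le:
  assumes "x \<in> \<Omega>" "j \<in> I"
  shows "norm (v I x) \<le> 2 * norm (g j x)"
proof -
  have "I \<noteq> {}" using assms by blast
  then have "norm (v I x) * (norm (v I x) / 2 - norm (g j x)) \<le> 0"
    using direction_objective_ge[OF assms(2), of "v I x" x] theta_nonpos[of x I] theta_eq[of x I]
      assms by simp
  moreover have "0 < norm (v I x) * (norm (v I x) / 2 - norm (g j x))"
    if "2 * norm (g j x) < norm (v I x)"
    using that norm_ge_zero[of "g j x"] by (intro mult_pos_pos) linarith+
  ultimately show ?thesis by linarith
qed

text \<open>A feasible direction of negative slope at \<open>xbar\<close> leads to a point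
  \<open>e\<close> with negative objective at \<open>e - xbar\<close>. By continuity the objectives
  at \<open>e - x k\<close>, which bound \<open>\<theta> UNIV (x k)\<close> from above, would have a
  negative limit.\<close>

lemma pareto_stationary_limit:
  assumes x: "\<And>k. x k \<in> \<Omega>" "x \<longlonglongrightarrow> xbar" and \<theta>: "(\<lambda>k. \<theta> UNIV (x k)) \<longlonglongrightarrow> 0"
  shows "pareto_stationary F \<Omega> xbar"
proof -
  have xbar: "xbar \<in> \<Omega>"
    using closed_sequentially[OF closed] x by blast
  have nonneg: "0 \<le> max_slope F UNIV xbar w" if "w \<in> feasible_directions \<Omega> xbar" for w
  proof (rule ccontr)
    assume neg: "\<not> 0 \<le> max_slope F UNIV xbar w"
    obtain t' where t': "t' > 0" "\<And>t. 0 \<le> t \<Longrightarrow> t \<le> t' \<Longrightarrow> xbar + t *\<^sub>R w \<in> \<Omega>"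
      using \<open>w \<in> _\<close> by (auto simp: feasible_directions_def)
    let ?s = "max_slope F UNIV xbar w"
    \<comment> \<open>Small enough for the slope to outweigh the quadratic term; the summand 1 keeps
      the denominator positive when \<open>w = 0\<close>.\<close>
    define t where "t = min t' (- ?s / ((norm w)\<^sup>2 + 1))"
    have w: "(norm w)\<^sup>2 + 1 > 0" by (simp add: add_nonneg_pos)
    have t: "0 < t" "t \<le> t'" "t \<le> - ?s / ((norm w)\<^sup>2 + 1)"
      using t'(1) neg w by (auto simp: t_def divide_less_0_iff)
    from t(3) have t4: "t * (norm w)\<^sup>2 + t \<le> - ?s"
      unfolding pos_le_divide_eq[OF w] by (simp add: algebra_simps)
    \<comment> \<open>The end point is held fixed instead of the direction: \<open>e - x k\<close>
      is feasible at every \<open>x k\<close>, which \<open>t *\<^sub>R w\<close> need not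
      be.\<close>
    define e where "e = xbar + t *\<^sub>R w"
    have e: "e \<in> \<Omega>" using t t'(2) by (simp add: e_def)
    have "direction_objective F UNIV xbar (t *\<^sub>R w) = t * (?s + t * (norm w)\<^sup>2 / 2)"
      using t(1) by (simp add: direction_objective_def max_slope_scaleR algebra_simps power2_eq_square)
    moreover have "t * (norm w)\<^sup>2 \<ge> 0" using t(1) by simp
    then have "?s + t * (norm w)\<^sup>2 / 2 < 0"
      using t t4 by linarith
    ultimately have "direction_objective F UNIV xbar (e - xbar) < 0"
      using t(1) by (simp add: e_def mult_pos_neg)
    moreover have "(\<lambda>k. direction_objective F UNIV (x k) (e - x k))
        \<longlonglongrightarrow> direction_objective F UNIV xbar (e - xbar)"
      using continuous_on_tendsto_compose[OF continuous_direction_objective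
          tendsto_Pair[OF x(2) tendsto_diff[OF tendsto_const[of e] x(2)]]] by simp
    moreover have "\<theta> UNIV (x k) \<le> direction_objective F UNIV (x k) (e - x k)" for k
      using theta_le[of "x k" UNIV "e - x k"] x(1) e by simp
    ultimately show False
      using LIMSEQ_le[OF \<theta>] by (meson not_le)
  qed
  have "0 \<in> feasible_directions \<Omega> xbar"
    using xbar by (auto simp: feasible_directions_def intro: exI[of _ 1])
  then show ?thesis
    using nonneg xbar unfolding pareto_stationary_def
    by (auto simp: is_arg_min_linorder max_slope_zero intro!: exI[of _ 0])
qed

text \<open>
  On the compact set, \<open>D\<close> is bounded away from zero and the gradients are uniformly continuous
  along the bounded steps, so one threshold serves all points.
\<close>
lemma uniform_armijo_step:
  assumes L: "compact L" "L \<subseteq> \<Omega>" and "\<gamma> < 1" "0 < e"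
  obtains a where "0 < a"
    "\<And>x t. x \<in> L \<Longrightarrow> \<theta> UNIV x \<le> - e \<Longrightarrow> 0 \<le> t \<Longrightarrow> t \<le> a \<Longrightarrow>
       F (x + t *\<^sub>R v UNIV x) \<le> F x + (\<gamma> * t * D x) *\<^sub>R 1"
proof -
  \<comment> \<open>\<open>undefined\<close> serves as an arbitrary index, since any one gradient
    bounds the directions.\<close>
  have "bounded (g undefined ` L)"
    by (intro compact_imp_bounded compact_continuous_image L
        continuous_on_subset[OF continuous_grad]) auto
  then obtain b where b: "b > 0" "\<And>x. x \<in> L \<Longrightarrow> norm (g undefined x) \<le> b"
    by (auto simp: bounded_pos)
  define B where "B = 2 * b"
  have B: "B > 0" "norm (v UNIV x) \<le> B" if "x \<in> L" for x
    using b norm_descent_dir_le[of x undefined UNIV] L that by (force simp: B_def)+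
  have B0: "B > 0" using b by (simp add: B_def)
  \<comment> \<open>This set contains every segment from a point \<open>x\<close> of
    \<open>L\<close> to \<open>x + v UNIV x\<close>.\<close>
  define L' where "L' = {x + y | x y. x \<in> L \<and> y \<in> cball 0 B}"
  \<comment> \<open>Chosen so that \<open>\<eta> * B = (1 - \<gamma>) * e\<close>, the least gap
    between \<open>D x\<close> and \<open>\<gamma> * D x\<close> when
    \<open>D x \<le> - e\<close>.\<close>
  define \<eta> where "\<eta> = (1 - \<gamma>) * e / B"
  have \<eta>: "\<eta> > 0" using assms B0 by (simp add: \<eta>_def)
  have "compact L'" unfolding L'_def by (intro compact_sums L) simp
  then have "uniformly_continuous_on L' (g j)" for j
    by (intro compact_uniformly_continuous continuous_on_subset[OF continuous_grad]) auto
  then have "\<forall>j. \<exists>r>0. \<forall>x\<in>L'. \<forall>y\<in>L'. dist y x < r \<longrightarrow> dist (g j y) (g j x) < \<eta>"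
    using \<eta> unfolding uniformly_continuous_on_def by blast
  then obtain r where r: "\<And>j. r j > 0"
    "\<And>j x y. x \<in> L' \<Longrightarrow> y \<in> L' \<Longrightarrow> dist y x < r j \<Longrightarrow> dist (g j y) (g j x) < \<eta>"
    by metis
  define R where "R = Min (range r)"
  have R: "R > 0" "R \<le> r j" for j
    using r(1) by (auto simp: R_def)
  \<comment> \<open>The cap 1 keeps the steps in the ball of radius \<open>B\<close>; the other term
    makes them shorter than \<open>R\<close>, which serves all gradients.\<close>
  define a where "a = min 1 (R / (2 * B))"
  have a: "0 < a" "a \<le> 1" "a * B < R"
    using R(1) B0 by (auto simp: a_def min_def divide_simps)
  show thesis
  proof (rule that[OF a(1)])
    fix x t assume x: "x \<in> L" "\<theta> UNIV x \<le> - e" and t: "0 \<le> t" "t \<le> a"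
    let ?v = "v UNIV x"
    have Dx: "D x \<le> - e"
      using max_slope_descent_dir_le[of x] x L by auto
    have "F (x + t *\<^sub>R ?v) $ j \<le> F x $ j + \<gamma> * t * D x" for j
    proof (cases "t = 0")
      case False
      have "((\<lambda>s. F (x + s *\<^sub>R ?v) $ j) has_real_derivative g j (x + s *\<^sub>R ?v) \<bullet> ?v) (at s)" for s
      proof -
        have "((\<lambda>s. x + s *\<^sub>R ?v) has_derivative (\<lambda>h. h *\<^sub>R ?v)) (at s)"
          by (auto intro!: derivative_eq_intros)
        from has_derivative_compose[OF this has_derivative_component] show ?thesis
          unfolding has_field_derivative_def
          by (rule has_derivative_eq_rhs) (simp add: fun_eq_iff inner_commute mult.commute)
      qed
      moreover have "0 < t" using False t by simp
      ultimately obtain s where s: "0 < s" "s < t"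
        "F (x + t *\<^sub>R ?v) $ j - F (x + 0 *\<^sub>R ?v) $ j = (t - 0) * (g j (x + s *\<^sub>R ?v) \<bullet> ?v)"
        using MVT2[of 0 t "\<lambda>s. F (x + s *\<^sub>R ?v) $ j" "\<lambda>s. g j (x + s *\<^sub>R ?v) \<bullet> ?v"] by blast
      have "norm (s *\<^sub>R ?v) \<le> a * B"
        using s t a B[OF x(1)] by (auto intro!: mult_mono)
      moreover have "a * B \<le> B" using a B0 by simp
      ultimately have step: "norm (s *\<^sub>R ?v) \<le> B" "norm (s *\<^sub>R ?v) < r j"
        using a(3) R(2)[of j] by linarith+
      have "x + y \<in> L'" if "norm y \<le> B" for y
        unfolding L'_def using x(1) that by auto
      from this[of 0] this[OF step(1)] have "x \<in> L'" "x + s *\<^sub>R ?v \<in> L'"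
        using B0 by simp_all
      then have near: "norm (g j (x + s *\<^sub>R ?v) - g j x) < \<eta>"
        using r(2)[of x "x + s *\<^sub>R ?v" j] step(2) by (simp add: dist_norm)
      have "g j (x + s *\<^sub>R ?v) \<bullet> ?v = g j x \<bullet> ?v + (g j (x + s *\<^sub>R ?v) - g j x) \<bullet> ?v"
        by (simp add: inner_diff_left)
      also have "\<dots> \<le> D x + norm (g j (x + s *\<^sub>R ?v) - g j x) * norm ?v"
        by (intro add_mono max_slope_ge norm_cauchy_schwarz) simp
      also have "\<dots> \<le> D x + \<eta> * B"
        using near B[OF x(1)] \<eta> by (intro add_left_mono mult_mono) auto
      also have "\<eta> * B = (1 - \<gamma>) * e"
        using B0 by (simp add: \<eta>_def)
      also have "D x + (1 - \<gamma>) * e \<le> \<gamma> * D x"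
        using mult_left_mono[OF Dx, of "1 - \<gamma>"] assms(3) by (simp add: algebra_simps)
      finally have "t * (g j (x + s *\<^sub>R ?v) \<bullet> ?v) \<le> t * (\<gamma> * D x)"
        using t by (intro mult_left_mono)
      then show ?thesis
        using s(3) by (simp add: algebra_simps)
    qed simp
    then show "F (x + t *\<^sub>R ?v) \<le> F x + (\<gamma> * t * D x) *\<^sub>R 1"
      by (simp add: less_eq_vec_def)
  qed
qed

end

section \<open>Dominance\<close>

lemma dominates_trans_le: "a \<le> b \<Longrightarrow> dominates b c \<Longrightarrow> dominates a c"
  unfolding dominates_def by (metis order.trans order.antisym)

lemma not_dominates_self: "\<not> dominates a a"
  by (simp add: dominates_def)

text \<open>Being transitive and stable under the removal of dominated points from a finite set,
  this relation tracks progress without knowledge of which points are kept.\<close>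

definition covers :: "('a \<Rightarrow> real^'m) \<Rightarrow> 'a set \<Rightarrow> 'a set \<Rightarrow> bool" where
  "covers F A B \<longleftrightarrow> (\<forall>a\<in>A. \<exists>b\<in>B. F b \<le> F a)"

lemma coversD: "covers F A B \<Longrightarrow> a \<in> A \<Longrightarrow> \<exists>b\<in>B. F b \<le> F a"
  by (simp add: covers_def)

lemma covers_trans: "covers F A B \<Longrightarrow> covers F B E \<Longrightarrow> covers F A E"
  unfolding covers_def by (meson order.trans)

lemma covers_mono: "A' \<subseteq> A \<Longrightarrow> B \<subseteq> B' \<Longrightarrow> covers F A B \<Longrightarrow> covers F A' B'"
  unfolding covers_def by blast

lemma covers_refl: "covers F A A"
  unfolding covers_def by blast

lemma covers_insertD: "covers F (insert z A) B \<Longrightarrow> covers F A B"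
  unfolding covers_def by blast

text \<open>Only points dominated by \<open>z\<close> disappear, and \<open>z\<close> stays because
  dominance is irreflexive.\<close>

lemma covers_insert_point: "covers F (insert z X) (insert_point F z X)"
  unfolding covers_def
proof
  fix a assume "a \<in> insert z X"
  moreover have "z \<in> insert_point F z X"
    by (simp add: insert_point_def not_dominates_self)
  ultimately show "\<exists>b\<in>insert_point F z X. F b \<le> F a"
    by (cases "a \<in> insert_point F z X") (auto simp: insert_point_def dominates_def)
qed

text \<open>The finitely many images below \<open>F a\<close> have a minimal element; an image
  dominating it would lie below \<open>F a\<close> too.\<close>

lemma covers_nondominated:
  assumes "finite A"
  shows "covers F A (nondominated F A)"
  unfolding covers_def
proof
  fix a assume a: "a \<in> A"
  let ?S = "{y \<in> F ` A. y \<le> F a}"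
  have "finite ?S" "?S \<noteq> {}" using assms a by auto
  then obtain m where m: "m \<in> ?S" "\<And>y. y \<in> ?S \<Longrightarrow> y \<le> m \<Longrightarrow> m = y"
    using finite_has_minimal[of ?S] by blast
  then obtain b where b: "b \<in> A" "F b = m" "m \<le> F a" by blast
  have "\<not> dominates (F y) (F b)" if "y \<in> A" for y
    using m(2)[of "F y"] that b by (auto simp: dominates_def)
  then show "\<exists>b\<in>nondominated F A. F b \<le> F a"
    using b by (auto simp: nondominated_def)
qed

lemma mutually_nondominated_nondominated: "mutually_nondominated F (nondominated F A)"
  by (auto simp: mutually_nondominated_def nondominated_def)

lemma candidates_subset: "candidates F A B E \<subseteq> A \<union> B \<union> E"
  by (auto simp: candidates_def nondominated_def Let_def)

lemma covers_candidates:
  assumes "finite B" "finite E"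
  shows "covers F (B \<union> E) (candidates F A B E)"
  by (rule covers_mono[OF _ _ covers_nondominated[of "B \<union> E"]])
    (use assms in \<open>auto simp: candidates_def Let_def\<close>)

text \<open>
  A point left out of the candidate set is weakly below some nondominated point, whereas a point
  taken into it serves as its own witness.
\<close>
lemma ex_candidate_above:
  assumes "x \<in> A"
  shows "\<exists>c\<in>candidates F A B E. F x \<le> F c"
proof (cases "x \<in> candidates F A B E")
  case False
  then show ?thesis
    using assms by (auto simp: candidates_def Let_def less_eq_vec_def not_less)
qed blast

text \<open>A dominated point from \<open>A\<close> contradicts the assumptions. For one that
  survived the filtering of \<open>B \<union> E\<close>, the dominating point is either another
  survivor, excluded by the filtering, or an added point, excluded by its admission test.\<close>

lemma mutually_nondominated_candidates:
  assumes A: "mutually_nondominated F A"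
    and not_below: "\<And>x y. x \<in> A \<Longrightarrow> y \<in> B \<union> E \<Longrightarrow> \<not> dominates (F y) (F x)"
  shows "mutually_nondominated F (candidates F A B E)"
  unfolding mutually_nondominated_def
proof (intro notI, elim bexE)
  let ?N = "nondominated F (B \<union> E)"
  fix x y
  assume x: "x \<in> candidates F A B E" and y: "y \<in> candidates F A B E" and d: "dominates (F y) (F x)"
  have N: "?N \<subseteq> B \<union> E" by (auto simp: nondominated_def)
  consider "x \<in> ?N" "y \<in> ?N" | "x \<in> A" | "x \<in> ?N" "\<forall>z\<in>?N. \<exists>j. F z $ j < F y $ j"
    using x y by (auto simp: candidates_def Let_def)
  then show False
  proof cases
    case 1
    then show False
      using d by (auto simp: nondominated_def)
  next
    case 2
    then show False
      using d A not_below y N candidates_subset[of F A B E] by (auto simp: mutually_nondominated_def)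
  next
    case 3
    then obtain j where "F x $ j < F y $ j" by blast
    moreover have "F y $ j \<le> F x $ j"
      using d by (simp add: dominates_def less_eq_vec_def)
    ultimately show False by simp
  qed
qed

section \<open>The loops\<close>

lemma for_each_invariant:
  assumes "for_each R xs s s'" "P s" "\<And>x s s'. x \<in> set xs \<Longrightarrow> R x s s' \<Longrightarrow> P s \<Longrightarrow> P s'"
  shows "P s'"
  using assms by (induction xs arbitrary: s) auto

lemma largest_step_in_range:
  assumes "largest_step \<alpha>0 \<delta> P \<alpha>" "0 < \<alpha>0" "\<alpha>0 \<le> 1" "0 < \<delta>" "\<delta> < 1"
  shows "0 \<le> \<alpha>" "\<alpha> \<le> 1"
  using assms by (auto simp: largest_step_def is_arg_max_linorder intro!: mult_le_one power_le_one)

text \<open>Maximality excludes the previous trial \<open>\<alpha> / \<delta>\<close>, so that one lies beyond \<open>a\<close>.\<close>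
lemma largest_step_ge:
  assumes step: "largest_step \<alpha>0 \<delta> P \<alpha>" and P: "\<And>t. 0 \<le> t \<Longrightarrow> t \<le> a \<Longrightarrow> P t"
    and \<alpha>0: "0 < \<alpha>0" and \<delta>: "0 < \<delta>" "\<delta> < 1"
  shows "min \<alpha>0 (\<delta> * a) \<le> \<alpha>"
proof -
  obtain h where h: "\<alpha> = \<alpha>0 * \<delta> ^ h"
    using step by (auto simp: largest_step_def is_arg_max_linorder)
  show ?thesis
  proof (cases h)
    case (Suc i)
    have "\<alpha> < \<alpha>0 * \<delta> ^ i"
      using h Suc \<alpha>0 \<delta> by simp
    then have "\<not> P (\<alpha>0 * \<delta> ^ i)"
      using step by (fastforce simp: largest_step_def is_arg_max_def)
    moreover have "0 \<le> \<alpha>0 * \<delta> ^ i"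
      using \<alpha>0 \<delta> by simp
    ultimately have "a < \<alpha>0 * \<delta> ^ i"
      using P by (meson not_le)
    then have "\<delta> * a < \<delta> * (\<alpha>0 * \<delta> ^ i)"
      using \<delta> by (intro mult_strict_left_mono)
    also have "\<delta> * (\<alpha>0 * \<delta> ^ i) = \<alpha>"
      using h Suc by simp
    finally show ?thesis by simp
  qed (simp add: h)
qed

context smooth_problem
begin

text \<open>The loop invariant: \<open>A\<close> is the set whose covering is maintained,
  \<open>B\<close> the current set. Finiteness is carried along for
  \<open>covers_nondominated\<close>.\<close>

abbreviation refines :: "(real^'n) set \<Rightarrow> (real^'n) set \<Rightarrow> bool" where
  "refines A B \<equiv> finite B \<and> B \<subseteq> \<Omega> \<and> covers F A B"

lemma refines_insert_point:
  assumes "refines A Y" "z \<in> \<Omega>"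
  shows "refines (insert z A) (insert_point F z Y)"
proof -
  have "covers F (insert z A) (insert z Y)"
    using assms(1) by (auto simp: covers_def)
  then have "covers F (insert z A) (insert_point F z Y)"
    using covers_insert_point by (rule covers_trans)
  then show ?thesis
    using assms by (auto simp: insert_point_def)
qed

lemma partial_step_refines:
  assumes step: "partial_step F \<Omega> \<alpha>0 \<delta> z I s s'" and params: "0 < \<alpha>0" "\<alpha>0 \<le> 1" "0 < \<delta>" "\<delta> < 1"
    and "z \<in> \<Omega>" "I \<noteq> {}" "refines A (fst s)"
  shows "refines A (fst s')"
proof (cases "z \<in> fst s")
  case True
  then obtain \<alpha> w where \<alpha>: "largest_step \<alpha>0 \<delta>
      (\<lambda>a. \<forall>y\<in>fst s. \<exists>j. F (z + a *\<^sub>R v I z) $ j < F y $ j) \<alpha>"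
    and w: "w = z + \<alpha> *\<^sub>R v I z" "fst s' = insert_point F w (fst s)"
    using step by (auto simp: partial_step_def split_beta)
  have "w \<in> \<Omega>"
    using descent_step_feasible[OF assms(6,7)] largest_step_in_range[OF \<alpha> params] w(1) by simp
  then show ?thesis
    using refines_insert_point[OF assms(8), of w] w(2) covers_insertD[of F w A] by simp
next
  case False
  then show ?thesis
    using step assms(8) by (auto simp: partial_step_def split_beta)
qed

lemma common_step_feasible:
  assumes "common_step F \<Omega> \<alpha>0 \<delta> \<gamma> s Y x \<alpha>" and params: "0 < \<alpha>0" "\<alpha>0 \<le> 1" "0 < \<delta>" "\<delta> < 1"
    and "x \<in> \<Omega>"
  shows "x + \<alpha> *\<^sub>R v UNIV x \<in> \<Omega>"
proof -
  have "\<alpha> = 0 \<or> (\<exists>P. largest_step \<alpha>0 \<delta> P \<alpha>)"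
    using assms(1) by (auto simp: common_step_def Let_def split: if_splits)
  then have "0 \<le> \<alpha>" "\<alpha> \<le> 1"
    using largest_step_in_range[OF _ params] by auto
  then show ?thesis
    using descent_step_feasible[OF assms(6)] by simp
qed

text \<open>A later partial step may delete the new point again, so what is recorded is that it
  remains covered.\<close>

lemma process_point_cases:
  assumes step: "process_point F \<Omega> \<alpha>0 \<delta> \<gamma> \<sigma> x s s'"
    and params: "0 < \<alpha>0" "\<alpha>0 \<le> 1" "0 < \<delta>" "\<delta> < 1"
    and x: "x \<in> \<Omega>" and s: "refines A (fst s)"
  obtains (skip) "\<exists>y\<in>fst s. dominates (F y) (F x)" "s' = s"
    | (descend) \<alpha> where "common_step F \<Omega> \<alpha>0 \<delta> \<gamma> \<sigma> (fst s) x \<alpha>"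
        "refines (insert (x + \<alpha> *\<^sub>R v UNIV x) A) (fst s')"
proof (cases "\<exists>y\<in>fst s. dominates (F y) (F x)")
  case True
  then show ?thesis
    using step skip by (auto simp: process_point_def split_beta prod_eq_iff)
next
  case False
  then obtain \<alpha> z Is where \<alpha>: "common_step F \<Omega> \<alpha>0 \<delta> \<gamma> \<sigma> (fst s) x \<alpha>"
    and z: "z = x + \<alpha> *\<^sub>R v UNIV x"
    and Is: "set Is = {I. I \<noteq> {} \<and> \<theta> I z < 0}"
    and loop: "for_each (partial_step F \<Omega> \<alpha>0 \<delta> z) Is
        (insert_point F z (fst s), insert z (snd s)) s'"
    using step by (auto simp: process_point_def split_beta)
  have z\<Omega>: "z \<in> \<Omega>"
    unfolding z by (rule common_step_feasible[OF \<alpha> params x])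
  have "refines (insert z A) (fst s')"
    using loop
  proof (rule for_each_invariant[where P = "\<lambda>s. refines (insert z A) (fst s)"])
    show "refines (insert z A) (fst (insert_point F z (fst s), insert z (snd s)))"
      using refines_insert_point[OF s z\<Omega>] by simp
  next
    fix I t t' assume "I \<in> set Is" "partial_step F \<Omega> \<alpha>0 \<delta> z I t t'" "refines (insert z A) (fst t)"
    then show "refines (insert z A) (fst t')"
      using partial_step_refines[OF _ params z\<Omega>] Is by blast
  qed
  then show ?thesis
    using \<alpha> z descend by blast
qed

lemma process_point_refines:
  assumes "process_point F \<Omega> \<alpha>0 \<delta> \<gamma> \<sigma> x s s'" "0 < \<alpha>0" "\<alpha>0 \<le> 1" "0 < \<delta>" "\<delta> < 1"
    "x \<in> \<Omega>" "refines A (fst s)"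
  shows "refines A (fst s')"
  using assms
proof (cases rule: process_point_cases)
  case (descend \<alpha>)
  then show ?thesis
    using covers_insertD[of F _ A "fst s'"] by blast
qed (use assms in simp)

lemma loop_refines:
  assumes "for_each (process_point F \<Omega> \<alpha>0 \<delta> \<gamma> \<sigma>) xs s s'" "0 < \<alpha>0" "\<alpha>0 \<le> 1" "0 < \<delta>" "\<delta> < 1"
    "set xs \<subseteq> \<Omega>" "refines A (fst s)"
  shows "refines A (fst s')"
  by (rule for_each_invariant[OF assms(1), where P = "\<lambda>s. refines A (fst s)"])
    (use assms process_point_refines in blast)+

text \<open>Outside the union, \<open>F x\<close> exceeds \<open>F x0\<close>, and hence
  \<open>F y\<close>, in every component.\<close>

lemma mem_sublevel:
  assumes "x \<in> \<Omega>" "F y \<le> F x0" "\<not> dominates (F y) (F x)"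
  shows "x \<in> (\<Union>j. {x \<in> \<Omega>. F x $ j \<le> F x0 $ j})"
proof (rule ccontr)
  assume "\<not> ?thesis"
  then have "F x0 $ j < F x $ j" for j
    using assms(1) by (auto simp: not_le)
  then have "F y $ j < F x $ j" for j
    using assms(2) by (meson less_eq_vec_def order_le_less_trans)
  then have "dominates (F y) (F x)"
    by (auto simp: dominates_def less_eq_vec_def less_imp_le)
  with assms(3) show False by blast
qed

end

section \<open>Runs of the algorithm\<close>

locale stable_run = smooth_problem F \<Omega>
  for F :: "real^'n \<Rightarrow> real^'m" and \<Omega> +
  fixes \<alpha>0 \<delta> \<gamma> :: real and \<sigma> :: "nat \<Rightarrow> real" and M :: nat
    and X Xl C Xhat Xbar G :: "nat \<Rightarrow> (real^'n) set"
    and ord :: "nat \<Rightarrow> (real^'n) list" and x0 :: "real^'n"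
  assumes params: "0 < \<alpha>0" "\<alpha>0 \<le> 1" "0 < \<delta>" "\<delta> < 1" and \<gamma>: "0 < \<gamma>" "\<gamma> < 1"
    and \<sigma>: "\<sigma> \<longlonglongrightarrow> 0"
    and start: "finite (X 0)" "X 0 \<subseteq> \<Omega>" "mutually_nondominated F (X 0)"
    and run: "fpd_nmt_run F \<Omega> \<alpha>0 \<delta> \<gamma> \<sigma> M X Xl C ord Xhat Xbar G"
    and same_selection: "\<And>k. k > 0 \<Longrightarrow> Xbar (k - 1) = Xl k"
    and first_point: "\<And>k. is_arg_min (\<theta> UNIV) (\<lambda>x. x \<in> X k) (hd (ord k))"
    and x0: "x0 \<in> X 0"
    and compact_sublevel: "compact (\<Union>j. {x \<in> \<Omega>. F x $ j \<le> F x0 $ j})"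
begin

abbreviation L :: "(real^'n) set" where
  "L \<equiv> \<Union>j. {x \<in> \<Omega>. F x $ j \<le> F x0 $ j}"

abbreviation Cprev :: "nat \<Rightarrow> (real^'n) set" where
  "Cprev k \<equiv> case k of 0 \<Rightarrow> {} | Suc i \<Rightarrow> C i"

text \<open>The second bound states the memory window without truncated subtraction; it forces the
  selected index to grow with \<open>k\<close>.\<close>

lemma Xl_cases:
  obtains i where "i \<le> k" "k \<le> i + M" "Xl k = X i"
proof -
  have "Xl k \<in> X ` {k - min k M..k}"
    using run by (simp add: fpd_nmt_run_def is_arg_min_def)
  then show ?thesis using that by auto
qed

lemma Xbar_cases: "Xbar k = Xhat k \<or> (\<exists>i\<le>k. Xbar k = X i)"
proof -
  have "Xbar k \<in> insert (Xhat k) (X ` {k - min k (M - 1)..k})"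
    using run unfolding fpd_nmt_run_def is_arg_min_def by blast
  then show ?thesis by auto
qed

lemma C_eq: "C k = candidates F (X k) (Xl k) (Cprev k)"
  using run unfolding fpd_nmt_run_def by blast

lemma set_ord: "set (ord k) = X k"
  using run unfolding fpd_nmt_run_def by blast

lemma loop:
  "for_each (process_point F \<Omega> \<alpha>0 \<delta> \<gamma> (\<sigma> k)) (ord k) (C k, G k) (Xhat k, G (Suc k))"
  using run unfolding fpd_nmt_run_def by blast

lemma X_Suc_Xbar: "X (Suc k) = nondominated F (Xhat k \<union> Xbar k)"
  using run unfolding fpd_nmt_run_def by blast

text \<open>Agreement of the selections means that \<open>X (Suc k)\<close> is filtered against the
  same set that enters \<open>C (Suc k)\<close>.\<close>

lemma X_Suc: "X (Suc k) = nondominated F (Xhat k \<union> Xl (Suc k))"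
  using X_Suc_Xbar[of k] same_selection[of "Suc k"] by simp

lemma hd_ord: "hd (ord k) \<in> X k" "x \<in> X k \<Longrightarrow> \<theta> UNIV (hd (ord k)) \<le> \<theta> UNIV x"
  using first_point[of k] by (auto simp: is_arg_min_linorder)

lemma Xhat_refines_if:
  assumes "finite (C k)" "C k \<subseteq> \<Omega>" "X k \<subseteq> \<Omega>"
  shows "refines (C k) (Xhat k)"
  using loop_refines[OF loop params, of k "C k"] assms set_ord by (simp add: covers_refl)

lemma C_finite_if:
  assumes "\<And>i. i \<le> k \<Longrightarrow> finite (X i) \<and> X i \<subseteq> \<Omega>" "finite (Cprev k)" "Cprev k \<subseteq> \<Omega>"
  shows "finite (C k) \<and> C k \<subseteq> \<Omega>"
proof -
  obtain i where "i \<le> k" "Xl k = X i" using Xl_cases by metis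
  then have "finite (X k \<union> Xl k \<union> Cprev k)" "X k \<union> Xl k \<union> Cprev k \<subseteq> \<Omega>"
    using assms(1)[of i] assms(1)[of k] assms(2,3) by auto
  moreover have "C k \<subseteq> X k \<union> Xl k \<union> Cprev k"
    unfolding C_eq[of k] by (rule candidates_subset)
  ultimately show ?thesis
    using finite_subset by blast
qed

text \<open>\<open>X\<close> and \<open>C\<close> depend on each other, hence the joint induction;
  it covers all \<open>i \<le> k\<close> because the selections may return earlier sets.\<close>

lemma finite_feasible: "(\<forall>i\<le>k. finite (X i) \<and> X i \<subseteq> \<Omega>) \<and> finite (C k) \<and> C k \<subseteq> \<Omega>"
proof (induction k)
  case 0
  then show ?case using start C_finite_if[of 0] by simp
next
  case (Suc k)
  then have "refines (C k) (Xhat k)" using Xhat_refines_if by blast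
  moreover from this have "finite (Xbar k)" "Xbar k \<subseteq> \<Omega>"
    using Xbar_cases[of k] Suc by metis+
  ultimately have "finite (X (Suc k))" "X (Suc k) \<subseteq> \<Omega>"
    by (auto simp: X_Suc_Xbar nondominated_def)
  then have "\<forall>i\<le>Suc k. finite (X i) \<and> X i \<subseteq> \<Omega>"
    using Suc by (auto simp: le_Suc_eq)
  then show ?case using C_finite_if[of "Suc k"] Suc by simp
qed

lemma X_finite: "finite (X k)" and X_feasible: "X k \<subseteq> \<Omega>"
  and C_finite: "finite (C k)" and C_feasible: "C k \<subseteq> \<Omega>"
  using finite_feasible by blast+

lemma Xl_finite: "finite (Xl k)"
  by (metis Xl_cases X_finite)

lemma Xhat_refines: "refines (C k) (Xhat k)"
  by (intro Xhat_refines_if C_finite C_feasible X_feasible)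

lemma covers_X: "covers F (Xhat k \<union> Xl (Suc k)) (X (Suc k))"
  unfolding X_Suc using Xhat_refines Xl_finite by (intro covers_nondominated) blast

lemma covers_C: "covers F (Xl k \<union> Cprev k) (C k)"
  unfolding C_eq[of k] using Xl_finite C_finite by (intro covers_candidates) (simp_all split: nat.split)

text \<open>\<open>C k\<close> enters the filtering of \<open>C (Suc k)\<close> as
  \<open>Cprev (Suc k)\<close>. Thus a decrease that has once reached \<open>C\<close>
  persists.\<close>

lemma covers_C_le: "i \<le> k \<Longrightarrow> covers F (C i) (C k)"
proof (induction k rule: dec_induct)
  case base
  show ?case by (rule covers_refl)
next
  case (step k)
  have "covers F (C k) (C (Suc k))"
    by (rule covers_mono[OF _ _ covers_C[of "Suc k"]]) auto
  with step.IH show ?case by (rule covers_trans)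
qed

section \<open>Mutual nondominance and the level set\<close>

lemma X_nondominated: "mutually_nondominated F (X k)"
  using start(3) by (cases k) (simp_all add: X_Suc mutually_nondominated_nondominated)

text \<open>
  This is where the two selections have to agree: \<open>X k\<close> is filtered against \<open>Xbar (k - 1)\<close> only.
\<close>
lemma X_not_dominated:
  assumes x: "x \<in> X k" and y: "y \<in> Xl k \<union> Cprev k"
  shows "\<not> dominates (F y) (F x)"
proof (cases k)
  case 0
  have "Xl 0 = X 0" using Xl_cases[of 0] by auto
  then show ?thesis
    using 0 x y start(3) by (auto simp: mutually_nondominated_def)
next
  case (Suc i)
  \<comment> \<open>Points of \<open>C i\<close> are traded for points of \<open>Xhat i\<close>
    weakly below them, against which \<open>X (Suc i)\<close> was filtered.\<close>
  have "covers F (Xl k \<union> C i) (Xl k \<union> Xhat i)"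
    using Xhat_refines[of i] by (auto simp: covers_def)
  then obtain z where z: "z \<in> Xl k \<union> Xhat i" "F z \<le> F y"
    using y Suc by (auto dest: coversD)
  then have "\<not> dominates (F z) (F x)"
    using x Suc by (auto simp: X_Suc nondominated_def)
  with z(2) show ?thesis
    using dominates_trans_le by blast
qed

lemma C_nondominated: "mutually_nondominated F (C k)"
  unfolding C_eq[of k]
  by (intro mutually_nondominated_candidates X_nondominated X_not_dominated)

text \<open>At iteration 0 the window contains only \<open>X 0\<close>, so \<open>C 0\<close> covers
  \<open>x0\<close>, and so do all later sets.\<close>

lemma ex_C_le_x0: "\<exists>c\<in>C k. F c \<le> F x0"
proof -
  have "Xl 0 = X 0" using Xl_cases[of 0] by auto
  then have "x0 \<in> Xl 0 \<union> Cprev 0" using x0 by simp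
  then show ?thesis
    using coversD[OF covers_trans[OF covers_C covers_C_le[of 0 k]]] by blast
qed

lemma ex_X_le_x0: "\<exists>y\<in>X k. F y \<le> F x0"
proof (cases k)
  case (Suc i)
  have "covers F (Xhat i) (X k)"
    unfolding Suc by (rule covers_mono[OF _ _ covers_X[of i]]) auto
  then have "covers F (C i) (X k)"
    using covers_trans[of F "C i" "Xhat i" "X k"] Xhat_refines[of i] by simp
  moreover obtain c where "c \<in> C i" "F c \<le> F x0" using ex_C_le_x0 by blast
  ultimately show ?thesis
    using coversD[of F "C i" "X k" c] by (meson order.trans)
qed (use x0 in auto)

lemma X_sublevel: "X k \<subseteq> L"
proof
  fix x assume x: "x \<in> X k"
  obtain y where "y \<in> X k" "F y \<le> F x0" using ex_X_le_x0 by blast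
  then show "x \<in> L"
    using x X_feasible X_nondominated by (intro mem_sublevel) (auto simp: mutually_nondominated_def)
qed

lemma C_sublevel: "C k \<subseteq> L"
proof
  fix x assume x: "x \<in> C k"
  obtain y where "y \<in> C k" "F y \<le> F x0" using ex_C_le_x0 by blast
  then show "x \<in> L"
    using x C_feasible C_nondominated by (intro mem_sublevel) (auto simp: mutually_nondominated_def)
qed

section \<open>The decrease at the first processed point\<close>

lemma ex_C_above:
  assumes "x \<in> X k"
  shows "\<exists>c\<in>C k. F x \<le> F c"
  unfolding C_eq[of k] by (rule ex_candidate_above[OF assms])

text \<open>Hence the loop does not skip its first point, which is tested against \<open>C k\<close>
  itself.\<close>

lemma hd_not_dominated: "\<not> (\<exists>y\<in>C k. dominates (F y) (F (hd (ord k))))"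
proof (intro notI, elim bexE)
  fix y assume y: "y \<in> C k" "dominates (F y) (F (hd (ord k)))"
  have "C k \<subseteq> X k \<union> Xl k \<union> Cprev k"
    unfolding C_eq[of k] by (rule candidates_subset)
  then consider "y \<in> X k" | "y \<in> Xl k \<union> Cprev k"
    using y(1) by blast
  then show False
  proof cases
    case 1
    then show False
      using y(2) hd_ord(1)[of k] X_nondominated[of k] unfolding mutually_nondominated_def by blast
  next
    case 2
    then show False
      using y(2) X_not_dominated[OF hd_ord(1)] by blast
  qed
qed

text \<open>For the first point the current set is still \<open>C k\<close>, so its line search
  compares with points of \<open>C k\<close>; the rest of the loop keeps the trial point
  covered.\<close>

lemma first_step:
  obtains \<alpha> where "common_step F \<Omega> \<alpha>0 \<delta> \<gamma> (\<sigma> k) (C k) (hd (ord k)) \<alpha>"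
    "\<exists>b\<in>Xhat k. F b \<le> F (hd (ord k) + \<alpha> *\<^sub>R v UNIV (hd (ord k)))"
proof -
  let ?x = "hd (ord k)"
  obtain xs where xs: "ord k = ?x # xs"
    using set_ord[of k] hd_ord(1)[of k] by (cases "ord k") auto
  then obtain s where s: "process_point F \<Omega> \<alpha>0 \<delta> \<gamma> (\<sigma> k) ?x (C k, G k) s"
    "for_each (process_point F \<Omega> \<alpha>0 \<delta> \<gamma> (\<sigma> k)) xs s (Xhat k, G (Suc k))"
    using loop[of k] by (metis for_each.simps(2))
  have x: "?x \<in> \<Omega>" and C: "refines (C k) (fst (C k, G k))"
    using hd_ord(1) X_feasible C_finite C_feasible by (auto simp: covers_refl)
  from s(1) params x C show thesis
  proof (cases rule: process_point_cases)
    case skip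
    then show ?thesis using hd_not_dominated by auto
  next
    case (descend \<alpha>)
    have "set xs \<subseteq> \<Omega>"
      using set_ord[of k] X_feasible[of k] by (subst (asm) xs) auto
    from loop_refines[OF s(2) params this descend(2)]
    have "covers F (insert (?x + \<alpha> *\<^sub>R v UNIV ?x) (C k)) (Xhat k)" by simp
    from coversD[OF this] have "\<exists>b\<in>Xhat k. F b \<le> F (?x + \<alpha> *\<^sub>R v UNIV ?x)" by simp
    then show ?thesis
      using that descend(1) by simp
  qed
qed

lemma Xhat_decrease:
  assumes a: "0 < a" "\<And>t. 0 \<le> t \<Longrightarrow> t \<le> a \<Longrightarrow>
      F (hd (ord k) + t *\<^sub>R v UNIV (hd (ord k))) \<le> F (hd (ord k)) + (\<gamma> * t * D (hd (ord k))) *\<^sub>R 1"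
    and e: "0 < e" "\<theta> UNIV (hd (ord k)) \<le> - e" "\<sigma> k < e"
  shows "\<exists>c\<in>C k. \<exists>b\<in>Xhat k. \<forall>j. F b $ j \<le> F c $ j - \<gamma> * min \<alpha>0 (\<delta> * a) * e"
proof -
  let ?x = "hd (ord k)"
  let ?P = "\<lambda>t. \<exists>c\<in>C k. F ?x \<le> F c \<and> F (?x + t *\<^sub>R v UNIV ?x) \<le> F c + (\<gamma> * t * D ?x) *\<^sub>R 1"
  obtain \<alpha> where \<alpha>: "common_step F \<Omega> \<alpha>0 \<delta> \<gamma> (\<sigma> k) (C k) ?x \<alpha>"
    "\<exists>b\<in>Xhat k. F b \<le> F (?x + \<alpha> *\<^sub>R v UNIV ?x)"
    using first_step by blast
  \<comment> \<open>This \<open>c\<close> selects the branch of the line search that compares with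
    points of the current set.\<close>
  obtain c where c: "c \<in> C k" "F ?x \<le> F c"
    using ex_C_above hd_ord(1) by blast
  have step: "largest_step \<alpha>0 \<delta> ?P \<alpha>"
    using \<alpha>(1) c e by (auto simp: common_step_def Let_def split: if_splits)
  \<comment> \<open>Armijo decrease relative to \<open>F ?x\<close> implies the relaxed test, since
    \<open>F ?x \<le> F c\<close>.\<close>
  have "?P t" if "0 \<le> t" "t \<le> a" for t
    using c order.trans[OF a(2)[OF that] add_right_mono[OF c(2)]] by blast
  then have \<alpha>_ge: "min \<alpha>0 (\<delta> * a) \<le> \<alpha>"
    using largest_step_ge[OF step _ params(1,3,4)] by blast
  have "D ?x \<le> - e"
    using max_slope_descent_dir_le[of ?x] hd_ord(1) X_feasible e(2) by fastforce
  moreover have "0 < min \<alpha>0 (\<delta> * a)"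
    using params a(1) by simp
  ultimately have "min \<alpha>0 (\<delta> * a) * e \<le> \<alpha> * (- D ?x)"
    using \<alpha>_ge e(1) by (intro mult_mono) linarith+
  then have D: "\<gamma> * \<alpha> * D ?x \<le> - (\<gamma> * min \<alpha>0 (\<delta> * a) * e)"
    using mult_left_mono[of "min \<alpha>0 (\<delta> * a) * e" "\<alpha> * (- D ?x)" \<gamma>] \<gamma>
    by (simp add: mult.assoc)
  \<comment> \<open>The witness at the accepted step may differ from \<open>c\<close>.\<close>
  obtain c' where c': "c' \<in> C k" "F (?x + \<alpha> *\<^sub>R v UNIV ?x) \<le> F c' + (\<gamma> * \<alpha> * D ?x) *\<^sub>R 1"
    using step by (auto simp: largest_step_def is_arg_max_linorder)
  obtain b where b: "b \<in> Xhat k" "F b \<le> F (?x + \<alpha> *\<^sub>R v UNIV ?x)"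
    using \<alpha>(2) by blast
  have "F b $ j \<le> F c' $ j + \<gamma> * \<alpha> * D ?x" for j
    using order.trans[OF b(2) c'(2)] by (simp add: less_eq_vec_def)
  then have "F b $ j \<le> F c' $ j - \<gamma> * min \<alpha>0 (\<delta> * a) * e" for j
    using D by (smt (verit))
  then show ?thesis using b(1) c'(1) by blast
qed

lemma theta_hd_frequently_small:
  assumes "0 < e"
  shows "\<exists>k\<ge>N. - e < \<theta> UNIV (hd (ord k))"
proof (rule ccontr)
  assume "\<not> ?thesis"
  then have \<theta>: "\<theta> UNIV (hd (ord k)) \<le> - e" if "N \<le> k" for k
    using that by (auto simp: not_less)
  have "eventually (\<lambda>k. \<sigma> k < e) sequentially"
    using order_tendstoD(2)[OF \<sigma> assms] .
  then obtain N1 where N1: "\<And>k. N1 \<le> k \<Longrightarrow> \<sigma> k < e"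
    by (auto simp: eventually_sequentially)
  have "L \<subseteq> \<Omega>" by blast
  from uniform_armijo_step[OF compact_sublevel this \<gamma>(2) assms]
  obtain a where a: "0 < a" "\<And>x t. x \<in> L \<Longrightarrow> \<theta> UNIV x \<le> - e \<Longrightarrow> 0 \<le> t \<Longrightarrow> t \<le> a \<Longrightarrow>
       F (x + t *\<^sub>R v UNIV x) \<le> F x + (\<gamma> * t * D x) *\<^sub>R 1"
    by blast
  define \<eta> where "\<eta> = \<gamma> * min \<alpha>0 (\<delta> * a) * e"
  have \<eta>: "0 < \<eta>" using a(1) \<gamma> params assms by (simp add: \<eta>_def)
  define N2 where "N2 = max N N1"
  have decrease: "\<exists>c\<in>C k. \<exists>b\<in>Xhat k. \<forall>j. F b $ j \<le> F c $ j - \<eta>" if "N2 \<le> k" for k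
    unfolding \<eta>_def using that \<theta>[of k] N1[of k] hd_ord(1)[of k] X_sublevel[of k] assms
    by (intro Xhat_decrease[OF a(1) a(2)]) (auto simp: N2_def)
  \<comment> \<open>The triple \<open>p\<close> consists of an iteration \<open>m\<close>, a later
    iteration \<open>k\<close> and a point \<open>c\<close> of \<open>C m\<close> such that
    \<open>C k\<close> has a point at least \<open>\<eta>\<close> below \<open>c\<close> in every
    component.\<close>
  have "\<exists>p. n \<le> fst p \<and> fst p < fst (snd p) \<and> snd (snd p) \<in> C (fst p) \<and>
      (\<exists>b\<in>C (fst (snd p)). \<forall>j. F b $ j \<le> F (snd (snd p)) $ j - \<eta>)" if "N2 \<le> n" for n
  proof -
    \<comment> \<open>The window then forces \<open>n + 1 \<le> i\<close>, so \<open>X i\<close>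
      results from an iteration \<open>m = i - 1\<close> with \<open>n \<le> m\<close>.\<close>
    define k where "k = n + M + 1"
    obtain i where i: "i \<le> k" "k \<le> i + M" "Xl k = X i" by (rule Xl_cases)
    then obtain m where m: "i = Suc m" "n \<le> m" by (cases i) (auto simp: k_def)
    have "N2 \<le> m" using m(2) that by simp
    then obtain c b where c: "c \<in> C m" "b \<in> Xhat m" "\<And>j. F b $ j \<le> F c $ j - \<eta>"
      using decrease by blast
    have "covers F (Xhat m) (X i)"
      unfolding m(1) by (rule covers_mono[OF _ _ covers_X[of m]]) auto
    moreover have "covers F (X i) (C k)"
      unfolding i(3)[symmetric] by (rule covers_mono[OF _ _ covers_C[of k]]) auto
    ultimately have "covers F (Xhat m) (C k)"
      by (rule covers_trans)
    then obtain b' where "b' \<in> C k" "F b' \<le> F b"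
      using c(2) by (auto dest: coversD)
    then have "\<exists>b\<in>C k. \<forall>j. F b $ j \<le> F c $ j - \<eta>"
      using c(3) by (meson less_eq_vec_def order.trans)
    moreover have "m < k" using m(1) i(1) by simp
    ultimately show ?thesis using c(1) m(2) by (intro exI[of _ "(m, k, c)"]) auto
  qed
  then obtain p where p: "\<And>n. N2 \<le> n \<Longrightarrow> n \<le> fst (p n)" "\<And>n. N2 \<le> n \<Longrightarrow> fst (p n) < fst (snd (p n))"
    "\<And>n. N2 \<le> n \<Longrightarrow> snd (snd (p n)) \<in> C (fst (p n))"
    "\<And>n. N2 \<le> n \<Longrightarrow> \<exists>b\<in>C (fst (snd (p n))). \<forall>j. F b $ j \<le> F (snd (snd (p n))) $ j - \<eta>"
    by metis
  \<comment> \<open>Each search starts at the iteration where the preceding decrease has reached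
    \<open>C\<close>.\<close>
  define s where "s = rec_nat N2 (\<lambda>_ n. fst (snd (p n)))"
  have s: "s 0 = N2" "s (Suc i) = fst (snd (p (s i)))" for i
    by (simp_all add: s_def)
  have s_ge: "N2 \<le> s i" for i
  proof (induction i)
    case (Suc i)
    then show ?case using p(1,2)[OF Suc] s by simp
  qed (simp add: s)
  have "s i \<le> s (Suc i)" for i
    using p(1,2)[OF s_ge, of i] s by simp
  then have s_mono: "i \<le> j \<Longrightarrow> s i \<le> s j" for i j
    by (rule lift_Suc_mono_le)
  define c where "c i = snd (snd (p (s i)))" for i
  have c: "c i \<in> C (fst (p (s i)))" for i
    using p(3)[OF s_ge] by (simp add: c_def)
  \<comment> \<open>Otherwise the decrease from \<open>c i\<close>, carried forward by
    \<open>covers_C_le\<close>, would give a point that dominates \<open>c j\<close> within the same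
    candidate set.\<close>
  have separated: "\<exists>l. F (c j) $ l \<le> F (c i) $ l - \<eta>" if "i < j" for i j
  proof (rule ccontr)
    assume "\<not> ?thesis"
    then have less: "F (c i) $ l - \<eta> < F (c j) $ l" for l by (simp add: not_le)
    have "s (Suc i) \<le> fst (p (s j))"
      using s_mono[of "Suc i" j] p(1)[OF s_ge, of j] that by simp
    moreover obtain b where "b \<in> C (s (Suc i))" "\<And>l. F b $ l \<le> F (c i) $ l - \<eta>"
      using p(4)[OF s_ge, of i] by (auto simp: c_def s)
    ultimately obtain b' where b': "b' \<in> C (fst (p (s j)))" "\<And>l. F b' $ l \<le> F (c i) $ l - \<eta>"
      using coversD[OF covers_C_le] by (meson less_eq_vec_def order.trans)
    have "F b' $ l < F (c j) $ l" for l
      using b'(2)[of l] less[of l] by simp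
    then have "dominates (F b') (F (c j))"
      by (auto simp: dominates_def less_eq_vec_def less_imp_le)
    then show False
      using b'(1) c[of j] C_nondominated by (auto simp: mutually_nondominated_def)
  qed
  have "compact (F ` L)"
    by (intro compact_continuous_image compact_sublevel continuous_on_subset[OF continuous_F]) simp
  moreover have "F (c i) \<in> F ` L" for i
    using c C_sublevel by blast
  ultimately obtain y r where r: "strict_mono (r :: nat \<Rightarrow> nat)" "((\<lambda>i. F (c i)) \<circ> r) \<longlonglongrightarrow> y"
    unfolding compact_def by meson
  \<comment> \<open>Late terms of the subsequence differ by less than \<open>\<eta>\<close> in every
    component, contrary to \<open>separated\<close>.\<close>
  then have "Cauchy (\<lambda>i. F (c (r i)))"
    using LIMSEQ_imp_Cauchy unfolding comp_def by blast
  from metric_CauchyD[OF this \<eta>] obtain n where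
    n: "\<And>i j. n \<le> i \<Longrightarrow> n \<le> j \<Longrightarrow> dist (F (c (r i))) (F (c (r j))) < \<eta>"
    by blast
  have "r n < r (Suc n)" using r(1) by (simp add: strict_mono_Suc_iff)
  then obtain l where l: "F (c (r (Suc n))) $ l \<le> F (c (r n)) $ l - \<eta>"
    using separated by blast
  have "F (c (r n)) $ l - F (c (r (Suc n))) $ l \<le> dist (F (c (r n))) (F (c (r (Suc n))))"
    using component_le_norm_cart[of "F (c (r n)) - F (c (r (Suc n)))" l] by (simp add: dist_norm)
  then show False
    using l n[of n "Suc n"] by simp
qed

text \<open>The first processed point attains the infimum, which turns
  \<open>theta_hd_frequently_small\<close> into a statement about \<open>set_theta\<close>.\<close>

lemma set_theta_eq: "set_theta F \<Omega> (X k) = \<theta> UNIV (hd (ord k))"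
  unfolding set_theta_def using hd_ord by (intro cInf_eq_minimum) auto

lemma set_theta_le: "x \<in> X k \<Longrightarrow> set_theta F \<Omega> (X k) \<le> \<theta> UNIV x"
  by (simp add: set_theta_eq hd_ord)

end

section \<open>Convergence\<close>

lemma tends_along_subseq:
  assumes "tends_along f a K" "strict_mono r" "range r \<subseteq> K"
  shows "(f \<circ> r) \<longlonglongrightarrow> a"
proof -
  have "filterlim r (inf sequentially (principal K)) sequentially"
    using assms filterlim_subseq by (auto simp: filterlim_inf filterlim_principal image_subset_iff)
  then show ?thesis
    using assms(1) unfolding tends_along_def comp_def by (rule filterlim_compose[rotated])
qed

lemma ex_tends_along:
  fixes f :: "nat \<Rightarrow> real"
  assumes "\<And>e N. 0 < e \<Longrightarrow> \<exists>k\<ge>N. \<bar>f k\<bar> < e"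
  shows "\<exists>K. infinite K \<and> tends_along f 0 K"
proof -
  have "\<exists>k>n. \<bar>f k\<bar> < inverse (Suc m)" for n m
    using assms[of "inverse (Suc m)" "Suc n"] by (auto simp: Suc_le_eq)
  \<comment> \<open>\<open>r 0\<close> is unconstrained: the bound \<open>inverse (Suc m)\<close>
    belongs to \<open>r (Suc m)\<close>, hence the shift by one below.\<close>
  then obtain r where r: "\<And>m. \<bar>f (r (Suc m))\<bar> < inverse (Suc m)" "\<And>m. r m < r (Suc m)"
    using dependent_nat_choice[of "\<lambda>_ _. True" "\<lambda>m n k. n < k \<and> \<bar>f k\<bar> < inverse (Suc m)"] by metis
  then have mono: "strict_mono r" by (simp add: strict_mono_Suc_iff)
  have "eventually (\<lambda>k. k \<in> range r \<longrightarrow> \<bar>f k\<bar> < e) sequentially" if "0 < e" for e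
  proof -
    obtain m where m: "inverse (Suc m) < e" using reals_Archimedean \<open>0 < e\<close> by blast
    have "\<bar>f (r n)\<bar> < e" if n: "r (Suc m) \<le> r n" for n
    proof -
      have "Suc m \<le> n" using mono n by (simp add: strict_mono_less_eq)
      then obtain i where i: "n = Suc i" "m \<le> i" by (cases n) auto
      have "\<bar>f (r n)\<bar> < inverse (Suc i)" using r(1) i by simp
      also have "\<dots> \<le> inverse (Suc m)" using i by simp
      finally show ?thesis using m by simp
    qed
    then show ?thesis by (auto simp: eventually_sequentially)
  qed
  then have "tends_along f 0 (range r)"
    by (auto simp: tends_along_def tendsto_iff eventually_inf_principal)
  moreover have "infinite (range r)"
    using mono range_inj_infinite strict_mono_imp_inj_on by blast
  ultimately show ?thesis by blast
qed

section \<open>Closedness and convexity of the box\<close>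

lemma closed_extended_box: "closed (extended_box l u)"
proof -
  have "extended_box l u =
      (\<Inter>i. {x. l i \<le> ereal (x $ i)} \<inter> {x. ereal (x $ i) \<le> u i})"
    by (auto simp: extended_box_def)
  then show ?thesis
    by (auto intro!: closed_INT closed_Collect_le continuous_intros)
qed

text \<open>As bounds may be infinite, combinations are compared with the minimum and maximum of the
  two real components, which avoids arithmetic in \<open>ereal\<close>.\<close>

lemma convex_extended_box: "convex (extended_box l u)"
proof (rule convexI)
  fix x y :: "real^'a" and a b :: real
  assume x: "x \<in> extended_box l u" and y: "y \<in> extended_box l u" and ab: "0 \<le> a" "0 \<le> b" "a + b = 1"
  have "l i \<le> ereal ((a *\<^sub>R x + b *\<^sub>R y) $ i) \<and> ereal ((a *\<^sub>R x + b *\<^sub>R y) $ i) \<le> u i" for i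
  proof
    have "a * - (x $ i) + b * - (y $ i) \<le> - min (x $ i) (y $ i)"
      by (rule convex_bound_le) (use ab in auto)
    then have "ereal (min (x $ i) (y $ i)) \<le> ereal ((a *\<^sub>R x + b *\<^sub>R y) $ i)"
      unfolding ereal_less_eq(3) by simp
    moreover have "l i \<le> ereal (min (x $ i) (y $ i))"
      using x y by (simp add: extended_box_def min_def)
    ultimately show "l i \<le> ereal ((a *\<^sub>R x + b *\<^sub>R y) $ i)" by (rule order.trans[rotated])
    have "a * x $ i + b * y $ i \<le> max (x $ i) (y $ i)"
      by (rule convex_bound_le) (use ab in auto)
    then have "ereal ((a *\<^sub>R x + b *\<^sub>R y) $ i) \<le> ereal (max (x $ i) (y $ i))"
      unfolding ereal_less_eq(3) by simp
    moreover have "ereal (max (x $ i) (y $ i)) \<le> u i"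
      using x y by (simp add: extended_box_def max_def)
    ultimately show "ereal ((a *\<^sub>R x + b *\<^sub>R y) $ i) \<le> u i" by (rule order.trans)
  qed
  then show "a *\<^sub>R x + b *\<^sub>R y \<in> extended_box l u"
    by (simp add: extended_box_def)
qed

theorem corollary2:
  fixes F :: "real^'n \<Rightarrow> real^'m"
    and l u :: "'n \<Rightarrow> ereal"
    and \<Omega> :: "(real^'n) set"
    and \<alpha>0 \<delta> \<gamma> :: real
    and \<sigma> :: "nat \<Rightarrow> real"
    and M :: nat
    and X Xl C Xhat Xbar G :: "nat \<Rightarrow> (real^'n) set"
    and ord :: "nat \<Rightarrow> (real^'n) list"
    and x0 :: "real^'n"
  assumes F_C1: "continuously_differentiable F"
    and box: "\<Omega> = extended_box l u" "\<Omega> \<noteq> {}"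
    and params: "0 < \<alpha>0" "\<alpha>0 \<le> 1" "0 < \<delta>" "\<delta> < 1" "0 < \<gamma>" "\<gamma> < 1" "0 < M"
    and sigma: "\<And>k. 0 \<le> \<sigma> k" "\<sigma> \<longlonglongrightarrow> 0"
    and start: "finite (X 0)" "X 0 \<subseteq> \<Omega>" "mutually_nondominated F (X 0)"
    and run: "fpd_nmt_run F \<Omega> \<alpha>0 \<delta> \<gamma> \<sigma> M X Xl C ord Xhat Xbar G"
    and same_selection: "\<And>k. k > 0 \<Longrightarrow> Xbar (k - 1) = Xl k"
    and first_point: "\<And>k. is_arg_min (theta F \<Omega> UNIV) (\<lambda>x. x \<in> X k) (hd (ord k))"
    and level_set: "x0 \<in> X 0" "compact (\<Union>j. {x \<in> \<Omega>. F x $ j \<le> F x0 $ j})"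
  shows "(\<exists>K. infinite K \<and> tends_along (\<lambda>k. set_theta F \<Omega> (X k)) 0 K) \<and>
         (\<forall>K x. infinite K \<and> tends_along (\<lambda>k. set_theta F \<Omega> (X k)) 0 K \<and> (\<forall>k. x k \<in> X k) \<longrightarrow>
            (\<exists>xbar. accumulation_point_along x K xbar) \<and>
            (\<forall>xbar. accumulation_point_along x K xbar \<longrightarrow> pareto_stationary F \<Omega> xbar))"
proof -
  interpret stable_run F \<Omega> \<alpha>0 \<delta> \<gamma> \<sigma> M X Xl C Xhat Xbar G ord x0
    using assms closed_extended_box[of l u] convex_extended_box[of l u] by unfold_locales auto
  show ?thesis
  proof (intro conjI allI impI)
    have nonpos: "\<theta> UNIV x \<le> 0" if "x \<in> X k" for x k
      using theta_nonpos[of x UNIV] that X_feasible by auto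
    have "\<exists>k\<ge>N. \<bar>set_theta F \<Omega> (X k)\<bar> < e" if e: "0 < e" for e N
    proof -
      obtain k where "N \<le> k" "- e < \<theta> UNIV (hd (ord k))"
        using theta_hd_frequently_small[OF e] by blast
      then show ?thesis
        using nonpos[OF hd_ord(1)[of k]] by (auto simp: set_theta_eq abs_less_iff intro!: exI[of _ k])
    qed
    then show "\<exists>K. infinite K \<and> tends_along (\<lambda>k. set_theta F \<Omega> (X k)) 0 K"
      by (rule ex_tends_along)
  next
    fix K x
    assume K: "infinite K \<and> tends_along (\<lambda>k. set_theta F \<Omega> (X k)) 0 K \<and> (\<forall>k. x k \<in> X k)"
    then have x: "x k \<in> X k" for k by blast
    \<comment> \<open>\<open>enumerate K\<close> lists \<open>K\<close> increasingly, so compactness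
      yields a subsequence with indices in \<open>K\<close>.\<close>
    have "\<forall>i. (x \<circ> enumerate K) i \<in> L"
      using x X_sublevel by fastforce
    then obtain y r where r: "strict_mono (r :: nat \<Rightarrow> nat)" "((x \<circ> enumerate K) \<circ> r) \<longlonglongrightarrow> y"
      using compact_sublevel unfolding compact_def by meson
    have "strict_mono (enumerate K \<circ> r)"
      using r(1) K strict_mono_enumerate strict_mono_o by blast
    moreover have "range (enumerate K \<circ> r) \<subseteq> K"
      using K enumerate_in_set by auto
    ultimately show "\<exists>xbar. accumulation_point_along x K xbar"
      using r(2) unfolding accumulation_point_along_def comp_assoc by blast
  next
    fix K x xbar
    assume K: "infinite K \<and> tends_along (\<lambda>k. set_theta F \<Omega> (X k)) 0 K \<and> (\<forall>k. x k \<in> X k)"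
      and "accumulation_point_along x K xbar"
    then obtain r where r: "strict_mono r" "range r \<subseteq> K" "(x \<circ> r) \<longlonglongrightarrow> xbar"
      by (auto simp: accumulation_point_along_def)
    have x: "x k \<in> X k" "x k \<in> \<Omega>" for k
      using K X_feasible by blast+
    have lower: "(\<lambda>i. set_theta F \<Omega> (X (r i))) \<longlonglongrightarrow> 0"
      using tends_along_subseq[OF _ r(1,2)] K by (force simp: comp_def)
    \<comment> \<open>These values lie between \<open>set_theta F \<Omega> (X (r i))\<close> and
      0.\<close>
    have "(\<lambda>i. \<theta> UNIV (x (r i))) \<longlonglongrightarrow> 0"
      by (rule tendsto_sandwich[OF _ _ lower tendsto_const])
        (use x set_theta_le theta_nonpos in auto)
    then show "pareto_stationary F \<Omega> xbar"
      using r(3) x(2) by (intro pareto_stationary_limit[of "x \<circ> r"]) (simp_all add: comp_def)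
  qed
qed

end
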